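(* Let $k \in \mathbb{Z}$, $n,r \in \mathbb{Z}_{\geq 0}$, and $\lambda\in\mathbb{C}$ with $\lambda\neq1$. Then \begin{equation*} C_{n}^{(k)}(x)=\sum_{m=0}^{n}\left\{\frac{(-1)^{m+r}}{(1-\lambda)^{r}}\sum_{l=0}^{n-m}\sum_{a=0}^{r}(-1)^{a}\binom{n}{l+m}\binom{r}{a} S_{1}(l+m,m)\lambda^{r-a}C_{n-m-l}^{(k)}(a)\right\}H_{m}^{(r)}(x|\lambda). \end{equation*}
   Context: For $k\in\mathbb{Z}$, $Lif_k(t)=\sum_{m=0}^{\infty}\frac{t^m}{m!(m+1)^k}$; the poly-Cauchy polynomials are defined by $\frac{Lif_k(\log(1+t))}{(1+t)^x}=\sum_{n\ge0} C_n^{(k)}(x)\frac{t^n}{n!}$. The Stirling numbers of the first kind are defined by $(\log(1+t))^m=m!\sum_{l\ge m}S_1(l,m)\frac{t^l}{l!}$. For $\lambda\in\mathbb{C}$, $\lambda\ne1$, the Frobenius–Euler polynomials of order $r$ are defined by $\left(\frac{1-\lambda}{e^t-\lambda}\right)^r e^{xt}=\sum_{n\ge0}H_n^{(r)}(x|\lambda)\frac{t^n}{n!}$. *)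

theory Defs
  imports "HOL-Computational_Algebra.Formal_Power_Series"
begin

text \<open>
  All generating functions are formal power series in \<open>t\<close> over the complex numbers:
  \<open>fps_ln 1\<close> is $\log(1+t)$, \<open>fps_binomial x\<close> is $(1+t)^x$ and \<open>fps_exp x\<close> is $e^{xt}$.
\<close>

definition Lif :: "int \<Rightarrow> complex fps" where
  "Lif k = Abs_fps (\<lambda>m. 1 / (fact m * (of_nat m + 1) powi k))"

definition poly_Cauchy :: "int \<Rightarrow> nat \<Rightarrow> complex \<Rightarrow> complex" where
  "poly_Cauchy k n x = fact n * fps_nth ((Lif k oo fps_ln 1) / fps_binomial x) n"

definition S1 :: "nat \<Rightarrow> nat \<Rightarrow> complex" where
  "S1 l m = fact l / fact m * fps_nth (fps_ln 1 ^ m) l"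

definition Frobenius_Euler :: "nat \<Rightarrow> nat \<Rightarrow> complex \<Rightarrow> complex \<Rightarrow> complex" where
  "Frobenius_Euler r n x lam =
     fact n * fps_nth ((fps_const (1 - lam) / (fps_exp 1 - fps_const lam)) ^ r * fps_exp x) n"

lemma poly_Cauchy_egf:
  "(Lif k oo fps_ln 1) / fps_binomial x = Abs_fps (\<lambda>n. poly_Cauchy k n x / fact n)"
  by (simp add: fps_eq_iff poly_Cauchy_def)

lemma S1_eq_0: "l < m \<Longrightarrow> S1 l m = 0"
  by (simp add: S1_def startsby_zero_power_prefix)

lemma S1_egf:
  "fps_ln 1 ^ m = fps_const (fact m) * Abs_fps (\<lambda>l. if l \<ge> m then S1 l m / fact l else 0)"
  by (auto simp: fps_eq_iff S1_def startsby_zero_power_prefix)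

lemma Frobenius_Euler_egf:
  "(fps_const (1 - lam) / (fps_exp 1 - fps_const lam)) ^ r * fps_exp x =
     Abs_fps (\<lambda>n. Frobenius_Euler r n x lam / fact n)"
  by (simp add: fps_eq_iff Frobenius_Euler_def)

end

theory Submission imports Defs begin

text \<open>
  Substituting \<open>t \<mapsto> -log(1+t)\<close> into the generating function of the Frobenius--Euler polynomials
  gives \<open>((1-\<lambda>) / ((1+t)\<^sup>-\<^sup>1 - \<lambda>))\<^sup>r (1+t)\<^sup>-\<^sup>x\<close>. Hence the generating function of the poly-Cauchy
  polynomials is this series multiplied by \<open>(1-\<lambda>)\<^sup>-\<^sup>r ((1+t)\<^sup>-\<^sup>1 - \<lambda>)\<^sup>r Lif\<^sub>k(log(1+t))\<close>. The binomial
  theorem turns the second factor into a combination of the generating functions of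
  \<open>C\<^sub>n(a)\<close>, \<open>0 \<le> a \<le> r\<close>, and the powers of \<open>log(1+t)\<close> contribute the Stirling numbers.
\<close>

unbundle fps_syntax

lemma fps_binomial_minus: "fps_binomial (- c :: 'a::field_char_0) = inverse (fps_binomial c)"
  by (rule sym, rule fps_inverse_unique) (simp flip: fps_binomial_add_mult)

text \<open>Both sides solve \<open>y' = - c * y / (1 + t)\<close> with constant term 1, and this
  initial value problem has only one formal solution.\<close>

lemma fps_exp_compose_minus_ln:
  "fps_exp c oo (- fps_ln 1) = fps_binomial (- c :: 'a::field_char_0)"
proof (subst fps_binomial_ODE_unique'[symmetric], intro conjI)
  show "fps_deriv (fps_exp c oo - fps_ln 1) =
      fps_const (- c) * (fps_exp c oo - fps_ln 1) / (1 + fps_X)"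
    by (simp add: fps_compose_deriv fps_ln_deriv fps_compose_mult_distrib fps_divide_unit
        flip: fps_const_neg)
qed simp

text \<open>As \<open>M\<close> has no constant term, \<open>M ^ m\<close> has no terms below degree
  \<open>m\<close>, so only \<open>m \<le> n\<close> can reach degree \<open>n\<close>.\<close>

lemma fps_mult_compose_nth:
  fixes F G M :: "'a::comm_ring_1 fps"
  assumes "M $ 0 = 0"
  shows "(F * (G oo M)) $ n = (\<Sum>m=0..n. G $ m * (F * M ^ m) $ n)"
proof -
  \<comment> \<open>The bound is \<open>n\<close> rather than \<open>i\<close>: the added terms
    vanish, and a range independent of \<open>i\<close> lets the two sums be swapped.\<close>
  have "(G oo M) $ i = (\<Sum>m=0..n. G $ m * (M ^ m) $ i)" if "i \<le> n" for i
    unfolding fps_compose_nth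
    by (rule sum.mono_neutral_left) (use that assms in \<open>auto simp: startsby_zero_power_prefix\<close>)
  hence "((G oo M) * F) $ n = (\<Sum>i=0..n. (\<Sum>m=0..n. G $ m * (M ^ m) $ i) * F $ (n - i))"
    by (simp add: fps_mult_nth)
  also have "\<dots> = (\<Sum>m=0..n. G $ m * (M ^ m * F) $ n)"
    unfolding fps_mult_nth sum_distrib_left sum_distrib_right
    by (subst sum.swap) (simp add: mult.assoc)
  finally show ?thesis by (simp add: mult.commute)
qed

lemma poly_Cauchy_eq:
  "poly_Cauchy k n x = fact n * ((Lif k oo fps_ln 1) * fps_binomial (- x)) $ n"
  by (simp add: poly_Cauchy_def fps_divide_unit fps_binomial_minus)

text \<open>This is a Cauchy product whose first factor starts in degree \<open>m\<close>, hence the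
  index \<open>l + m\<close>. The factorials normalising \<open>S1\<close> and
  \<open>poly_Cauchy\<close> combine with \<open>fact n\<close> into the binomial coefficient and
  leave \<open>fact m\<close>.\<close>

lemma ln_power_mult_poly_Cauchy_nth:
  assumes "m \<le> n"
  shows "fact n * (fps_ln 1 ^ m * ((Lif k oo fps_ln 1) * fps_binomial (- x))) $ n =
    fact m * (\<Sum>l=0..n - m. of_nat (n choose (l + m)) * S1 (l + m) m * poly_Cauchy k (n - m - l) x)"
proof -
  let ?P = "(Lif k oo fps_ln 1) * fps_binomial (- x)"
  have "(fps_ln 1 ^ m * ?P) $ n = (\<Sum>i=m..n. (fps_ln 1 ^ m) $ i * ?P $ (n - i))"
    unfolding fps_mult_nth
    by (rule sum.mono_neutral_right) (auto simp: startsby_zero_power_prefix)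
  also have "\<dots> = (\<Sum>l=0..n - m. (fps_ln 1 ^ m) $ (l + m) * ?P $ (n - (l + m)))"
    using sum.shift_bounds_cl_nat_ivl[of "\<lambda>i. (fps_ln 1 ^ m) $ i * ?P $ (n - i)" 0 m "n - m"] assms
    by simp
  finally have "fact n * (fps_ln 1 ^ m * ?P) $ n =
      (\<Sum>l=0..n - m. fact n * ((fps_ln 1 ^ m) $ (l + m) * ?P $ (n - (l + m))))"
    by (simp add: sum_distrib_left)
  also have "\<dots> = (\<Sum>l=0..n - m. fact m *
      (of_nat (n choose (l + m)) * S1 (l + m) m * poly_Cauchy k (n - m - l) x))"
  proof (rule sum.cong[OF refl])
    fix l assume "l \<in> {0..n - m}"
    hence le: "l + m \<le> n" using assms by auto
    have "n - m - l = n - (l + m)" by simp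
    thus "fact n * ((fps_ln 1 ^ m) $ (l + m) * ?P $ (n - (l + m))) =
        fact m * (of_nat (n choose (l + m)) * S1 (l + m) m * poly_Cauchy k (n - m - l) x)"
      by (simp only: binomial_fact[OF le] S1_def poly_Cauchy_eq) (simp add: field_simps)
  qed
  finally show ?thesis by (simp only: sum_distrib_left)
qed

text \<open>The denominator has constant term \<open>1 - lam\<close>, nonzero by hypothesis, so the
  division is a true inversion and commutes with the substitution.\<close>

lemma Frobenius_Euler_egf_compose_minus_ln:
  fixes lam x :: complex
  assumes "lam \<noteq> 1"
  shows "((fps_const (1 - lam) / (fps_exp 1 - fps_const lam)) ^ r * fps_exp x) oo (- fps_ln 1) =
    (fps_const (1 - lam) * inverse (fps_binomial (- 1) - fps_const lam)) ^ r * fps_binomial (- x)"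
  using assms
  by (simp add: fps_compose_mult_distrib fps_compose_power[symmetric] fps_divide_compose
      fps_compose_sub_distrib fps_exp_compose_minus_ln fps_divide_unit
      fps_inverse_compose)

theorem theorem9:
  fixes k :: int and n r :: nat and lam x :: complex
  assumes "lam \<noteq> 1"
  shows "poly_Cauchy k n x =
    (\<Sum>m=0..n.
      ((-1) ^ (m + r) / (1 - lam) ^ r *
        (\<Sum>l=0..n - m. \<Sum>a=0..r.
          (-1) ^ a * of_nat (n choose (l + m)) * of_nat (r choose a) * S1 (l + m) m
            * lam ^ (r - a) * poly_Cauchy k (n - m - l) (of_nat a)))
      * Frobenius_Euler r m x lam)"
proof -
  define F where "F = Lif k oo fps_ln 1"
  define G where "G = (fps_const (1 - lam) / (fps_exp 1 - fps_const lam)) ^ r * fps_exp x"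
  \<comment> \<open>\<open>u\<close> is the denominator after substitution, \<open>c\<close> cancels
    the numerator, and \<open>w a\<close> are the coefficients of \<open>u ^ r\<close> in powers of
    \<open>fps_binomial (- 1)\<close>.\<close>
  define u where "u = fps_binomial (- 1) - fps_const lam"
  define c where "c = 1 / (1 - lam) ^ r"
  define w where "w a = of_nat (r choose a) * (- lam) ^ (r - a)" for a
  have u0: "u $ 0 \<noteq> 0"
    using assms by (simp add: u_def)
  have "fps_const c * fps_const (1 - lam) ^ r = 1"
    using assms by (simp add: c_def fps_const_power)
  moreover have "u ^ r * inverse u ^ r = 1"
    by (simp add: inverse_mult_eq_1'[OF u0] flip: power_mult_distrib)
  moreover have "fps_const c * (F * u ^ r) * (G oo - fps_ln 1) =
      (fps_const c * fps_const (1 - lam) ^ r) * (u ^ r * inverse u ^ r) * (F * fps_binomial (- x))"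
    unfolding G_def Frobenius_Euler_egf_compose_minus_ln[OF assms] u_def[symmetric]
    by (simp only: power_mult_distrib mult_ac)
  ultimately have factor: "fps_const c * (F * u ^ r) * (G oo - fps_ln 1) = F * fps_binomial (- x)"
    by (simp only: mult_1)
  \<comment> \<open>Each summand contains the generating function of the poly-Cauchy polynomials at
    the argument \<open>a\<close>, since the \<open>a\<close>-th power of
    \<open>fps_binomial (- 1)\<close> is \<open>fps_binomial (- of_nat a)\<close>.\<close>
  have u_power: "F * u ^ r = (\<Sum>a=0..r. fps_const (w a) * (F * fps_binomial (- of_nat a)))"
  proof -
    have "u ^ r = (fps_binomial (- 1) + fps_const (- lam)) ^ r"
      by (simp add: u_def flip: fps_const_neg)
    also have "\<dots> = (\<Sum>a=0..r. fps_const (w a) * fps_binomial (- of_nat a))"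
      unfolding binomial_ring w_def atMost_atLeast0
      by (rule sum.cong[OF refl])
        (simp add: fps_binomial_power fps_const_power fps_of_nat[symmetric] mult_ac
          flip: fps_const_mult)
    finally show ?thesis
      by (simp add: sum_distrib_left mult_ac)
  qed
  have coeff: "fact n * (fps_const c * (F * u ^ r) * (- fps_ln 1) ^ m) $ n =
      (- 1) ^ m * c * fact m * (\<Sum>l=0..n - m. \<Sum>a=0..r. w a *
        (of_nat (n choose (l + m)) * S1 (l + m) m * poly_Cauchy k (n - m - l) (of_nat a)))"
    if "m \<le> n" for m
  proof -
    have "fps_const c * (F * u ^ r) * (- fps_ln 1) ^ m =
        (\<Sum>a=0..r. fps_const ((- 1) ^ m * c * w a) *
          (fps_ln 1 ^ m * (F * fps_binomial (- of_nat a))))"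
      unfolding u_power power_minus[of "fps_ln 1"] sum_distrib_left sum_distrib_right
      by (rule sum.cong[OF refl])
        (simp add: mult_ac fps_const_power[symmetric] flip: fps_const_mult fps_const_neg)
    hence "(fps_const c * (F * u ^ r) * (- fps_ln 1) ^ m) $ n = (\<Sum>a=0..r.
        (- 1) ^ m * c * w a * (fps_ln 1 ^ m * (F * fps_binomial (- of_nat a))) $ n)"
      by (simp only: fps_sum_nth fps_mult_left_const_nth)
    hence "fact n * (fps_const c * (F * u ^ r) * (- fps_ln 1) ^ m) $ n =
        (\<Sum>a=0..r. (- 1) ^ m * c * w a *
          (fact n * (fps_ln 1 ^ m * (F * fps_binomial (- of_nat a))) $ n))"
      by (simp only: sum_distrib_left) (simp only: mult_ac)
    also have "\<dots> = (\<Sum>a=0..r. \<Sum>l=0..n - m. (- 1) ^ m * c * fact m * (w a *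
        (of_nat (n choose (l + m)) * S1 (l + m) m * poly_Cauchy k (n - m - l) (of_nat a))))"
      unfolding F_def ln_power_mult_poly_Cauchy_nth[OF that] sum_distrib_left
      by (simp only: mult_ac)
    finally show ?thesis
      by (subst (asm) sum.swap) (simp only: sum_distrib_left)
  qed
  \<comment> \<open>For \<open>a \<le> r\<close> the numbers \<open>r + a\<close> and
    \<open>r - a\<close> have the same parity.\<close>
  have sign: "(- 1) ^ r * ((- 1) ^ a * lam ^ (r - a)) = (- lam) ^ (r - a)" if "a \<le> r" for a
  proof -
    have "(- 1 :: complex) ^ r * (- 1) ^ a = (- 1) ^ (r - a)"
      using that by (auto simp: minus_one_power_iff)
    thus ?thesis
      by (simp add: power_minus[of lam] flip: mult.assoc)
  qed
  have "poly_Cauchy k n x = (\<Sum>m=0..n. G $ m *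
      (fact n * (fps_const c * (F * u ^ r) * (- fps_ln 1) ^ m) $ n))"
    unfolding poly_Cauchy_eq F_def[symmetric] factor[symmetric]
    by (subst fps_mult_compose_nth) (simp_all add: sum_distrib_left mult_ac)
  \<comment> \<open>The \<open>fact m\<close> supplied by \<open>coeff\<close> turns
    \<open>G $ m\<close> into \<open>Frobenius_Euler r m x lam\<close>.\<close>
  also have "\<dots> = (\<Sum>m=0..n. ((- 1) ^ m * c * (\<Sum>l=0..n - m. \<Sum>a=0..r. w a *
        (of_nat (n choose (l + m)) * S1 (l + m) m * poly_Cauchy k (n - m - l) (of_nat a))))
      * Frobenius_Euler r m x lam)"
    by (rule sum.cong[OF refl]) (simp add: coeff Frobenius_Euler_def flip: G_def)
  also have "\<dots> = (\<Sum>m=0..n.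
      ((-1) ^ (m + r) / (1 - lam) ^ r *
        (\<Sum>l=0..n - m. \<Sum>a=0..r.
          (-1) ^ a * of_nat (n choose (l + m)) * of_nat (r choose a) * S1 (l + m) m
            * lam ^ (r - a) * poly_Cauchy k (n - m - l) (of_nat a)))
      * Frobenius_Euler r m x lam)"
  proof (rule sum.cong[OF refl], rule arg_cong[of _ _ "\<lambda>y. y * _"])
    fix m
    have "(\<Sum>l=0..n - m. \<Sum>a=0..r. w a *
          (of_nat (n choose (l + m)) * S1 (l + m) m * poly_Cauchy k (n - m - l) (of_nat a))) =
        (- 1) ^ r * (\<Sum>l=0..n - m. \<Sum>a=0..r.
          (-1) ^ a * of_nat (n choose (l + m)) * of_nat (r choose a) * S1 (l + m) m
            * lam ^ (r - a) * poly_Cauchy k (n - m - l) (of_nat a))"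
      unfolding sum_distrib_left
      by (intro sum.cong refl) (simp add: w_def mult_ac flip: sign)
    thus "(- 1) ^ m * c * (\<Sum>l=0..n - m. \<Sum>a=0..r. w a *
          (of_nat (n choose (l + m)) * S1 (l + m) m * poly_Cauchy k (n - m - l) (of_nat a))) =
        (-1) ^ (m + r) / (1 - lam) ^ r * (\<Sum>l=0..n - m. \<Sum>a=0..r.
          (-1) ^ a * of_nat (n choose (l + m)) * of_nat (r choose a) * S1 (l + m) m
            * lam ^ (r - a) * poly_Cauchy k (n - m - l) (of_nat a))"
      by (simp add: c_def power_add)
  qed
  finally show ?thesis .
qed

end
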